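(* Consider the translation invariant surface in $\mathbb{R}^3$ parameterised by $(u,v)\in\mathbb{R}^2\mapsto(z=z_0(u),\,t=v)$, with $\dot z_0\neq0$ and $z_0\neq0$, and the point source at the origin. The reflection of the point source off the surface is the line congruence $$\xi=-\xi_0^2\bar\xi_1,\qquad \eta=\left(\bar\xi_0-\xi_0\bar\xi_1^2\right)\xi_0^2\,r_0,$$ where $$\xi_1=\frac{-v\pm(v^2+z_0\bar z_0)^{1/2}}{\bar z_0},\qquad \xi_0=\pm\left[-\frac{\dot z_0}{\dot{\bar z}_0}\right]^{1/2},\qquad r_0=\frac{\bar\xi_0z_0+\xi_0\bar z_0+(1-\xi_0\bar\xi_0)v}{1+\xi_0\bar\xi_0}.$$ Here the $\pm$ in $\xi_1$ refers to the two oriented lines through the source that contain the given point $(z_0(u),v)$, and is chosen so that the ray goes from the source to the point of reflection; the sign in $\xi_0$ is a choice of orientation of the surface normal.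
   Context: Let $(x^1,x^2,x^3)$ be Euclidean coordinates on $\mathbb{R}^3$, $z=x^1+ix^2$, $t=x^3$. A dot denotes differentiation with respect to $u$. Directions in $S^2$ are given the coordinate $\xi\in\mathbb{C}$ by stereographic projection from the south pole: $\xi$ represents the unit vector with $z$-component $\frac{2\xi}{1+\xi\bar\xi}$ and $t$-component $\frac{1-\xi\bar\xi}{1+\xi\bar\xi}$. Oriented affine lines in $\mathbb{R}^3$ (with direction not the south pole) have coordinates $(\xi,\eta)\in\mathbb{C}^2$: the line $(\xi,\eta)$ has direction $\xi$, and its point at signed arclength $r\in\mathbb{R}$ from the point of the line closest to the origin is $$z=\frac{2(\eta-\bar\eta\xi^2)+2\xi(1+\xi\bar\xi)r}{(1+\xi\bar\xi)^2},\qquad t=\frac{-2(\eta\bar\xi+\bar\eta\xi)+(1-\xi^2\bar\xi^2)r}{(1+\xi\bar\xi)^2}.$$ A line congruence is a 2-parameter family of oriented lines, here given as functions $\xi(u,v),\eta(u,v)$. The lines through the origin are those with $\eta=0$. Reflection: an oriented line with unit direction $d$ that meets the surface at a point $q$, where the unit normal is $n$, is reflected to the oriented line through $q$ with direction $d-2(d\cdot n)n$. The reflection of the point source at the origin is the family of reflected lines obtained from the rays from the origin to the points $q=(z_0(u),v)$ of the surface. *)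

theory Defs
  imports "HOL-Analysis.Analysis"
begin

definition pt :: "complex \<Rightarrow> real \<Rightarrow> real^3" where
  "pt z t = vector [Re z, Im z, t]"

text \<open>Oriented affine lines, as pairs of a unit direction and the set of points.\<close>

type_synonym oline = "(real^3) \<times> (real^3) set"

definition oriented_line :: "real^3 \<Rightarrow> real^3 \<Rightarrow> oline" where
  "oriented_line p d = (d, range (\<lambda>r::real. p + r *\<^sub>R d))"

definition is_oriented_line :: "oline \<Rightarrow> bool" where
  "is_oriented_line l \<longleftrightarrow> (\<exists>p d. norm d = 1 \<and> l = oriented_line p d)"

text \<open>Inverse stereographic projection from the south pole. The argument of \<open>Re\<close>, here and
  in \<open>line_point\<close>, is a real number written as a complex expression.\<close>

definition stereo_dir :: "complex \<Rightarrow> real^3" where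
  "stereo_dir \<xi> =
     pt (2 * \<xi> / (1 + \<xi> * cnj \<xi>)) (Re ((1 - \<xi> * cnj \<xi>) / (1 + \<xi> * cnj \<xi>)))"

definition line_point :: "complex \<Rightarrow> complex \<Rightarrow> real \<Rightarrow> real^3" where
  "line_point \<xi> \<eta> r =
     pt ((2 * (\<eta> - cnj \<eta> * \<xi>^2) + 2 * \<xi> * (1 + \<xi> * cnj \<xi>) * of_real r) / (1 + \<xi> * cnj \<xi>)^2)
        (Re ((- 2 * (\<eta> * cnj \<xi> + cnj \<eta> * \<xi>) + (1 - \<xi>^2 * (cnj \<xi>)^2) * of_real r)
              / (1 + \<xi> * cnj \<xi>)^2))"

definition coord_line :: "complex \<Rightarrow> complex \<Rightarrow> oline" where
  "coord_line \<xi> \<eta> = (stereo_dir \<xi>, range (line_point \<xi> \<eta>))"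

definition unit_normal :: "(real \<Rightarrow> real \<Rightarrow> real^3) \<Rightarrow> real \<Rightarrow> real \<Rightarrow> real^3 \<Rightarrow> bool" where
  "unit_normal S u v n \<longleftrightarrow> norm n = 1
     \<and> n \<bullet> vector_derivative (\<lambda>u'. S u' v) (at u) = 0
     \<and> n \<bullet> vector_derivative (\<lambda>v'. S u v') (at v) = 0"

definition reflect_dir :: "real^3 \<Rightarrow> real^3 \<Rightarrow> real^3" where
  "reflect_dir n d = d - (2 * (d \<bullet> n)) *\<^sub>R n"

text \<open>Reflection off the surface \<open>S\<close> with unit normal field \<open>N\<close> of the rays from the source \<open>p\<close>;
  \<open>sgn\<close> normalises the vector from the source to the point of reflection.\<close>

definition source_reflection ::
  "real^3 \<Rightarrow> (real \<Rightarrow> real \<Rightarrow> real^3) \<Rightarrow> (real \<Rightarrow> real \<Rightarrow> real^3) \<Rightarrow> real \<Rightarrow> real \<Rightarrow> oline" where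
  "source_reflection p S N u v =
     oriented_line (S u v) (reflect_dir (N u v) (sgn (S u v - p)))"

definition cylinder :: "(real \<Rightarrow> complex) \<Rightarrow> real \<Rightarrow> real \<Rightarrow> real^3" where
  "cylinder z0 u v = pt (z0 u) v"

text \<open>In \<open>xi1\<close> and \<open>xi0\<close> the parameters \<open>\<sigma>\<close> and \<open>\<epsilon>\<close>, ranging over \<open>{1, -1}\<close>, are the signs
  \<open>\<plusminus>\<close>, and the square roots are principal ones.\<close>

definition xi1 :: "complex \<Rightarrow> complex \<Rightarrow> real \<Rightarrow> complex" where
  "xi1 \<sigma> z v = (- of_real v + \<sigma> * csqrt ((of_real v)^2 + z * cnj z)) / cnj z"

definition xi0 :: "complex \<Rightarrow> (real \<Rightarrow> complex) \<Rightarrow> real \<Rightarrow> complex" where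
  "xi0 \<epsilon> z0 u = \<epsilon> * csqrt (- (vector_derivative z0 (at u)
                              / vector_derivative (\<lambda>u'. cnj (z0 u')) (at u)))"

definition r0 :: "complex \<Rightarrow> complex \<Rightarrow> real \<Rightarrow> complex" where
  "r0 x0 z v = (cnj x0 * z + x0 * cnj z + (1 - x0 * cnj x0) * of_real v) / (1 + x0 * cnj x0)"

definition refl_xi :: "complex \<Rightarrow> complex \<Rightarrow> complex" where
  "refl_xi x0 x1 = - (x0^2) * cnj x1"

definition refl_eta :: "complex \<Rightarrow> complex \<Rightarrow> complex \<Rightarrow> real \<Rightarrow> complex" where
  "refl_eta x0 x1 z v = (cnj x0 - x0 * (cnj x1)^2) * x0^2 * r0 x0 z v"

end

(* The oriented line with direction xi through the point (z, t) has
   eta = (z - 2 t xi - conj(z) xi^2) / 2.  The unit normals are horizontal with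
   z-component xi0, |xi0| = 1, so reflection fixes t and maps z to - xi0^2 conj(z);
   on stereographic coordinates it is therefore xi |-> - xi0^2 conj(xi).  Inserting
   (z0, v) and the reflected direction into the formula for eta gives the claim, because
   y = conj(xi1) satisfies z y^2 + 2 v y = conj(z). *)

theory Submission
  imports Defs
begin

section \<open>Linear algebra and derivatives in the coordinates (z, t)\<close>

lemma pt_nth [simp]: "pt z t $ 1 = Re z" "pt z t $ 2 = Im z" "pt z t $ 3 = t"
  by (simp_all add: pt_def)

lemma pt_eq_iff [simp]: "pt z t = pt w s \<longleftrightarrow> z = w \<and> t = s"
  by (auto simp: vec_eq_iff forall_3 complex_eq_iff)

lemma pt_cases: obtains z t where "p = pt z t"
proof
  show "p = pt (Complex (p $ 1) (p $ 2)) (p $ 3)"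
    by (simp add: vec_eq_iff forall_3)
qed

lemma pt_zero [simp]: "pt 0 0 = 0"
  by (simp add: vec_eq_iff forall_3)

lemma pt_eq_0_iff [simp]: "pt z t = 0 \<longleftrightarrow> z = 0 \<and> t = 0"
  using pt_eq_iff[of z t 0 0] by (simp del: pt_eq_iff)

lemma pt_add: "pt z t + pt w s = pt (z + w) (t + s)"
  by (simp add: vec_eq_iff forall_3)

lemma pt_diff: "pt z t - pt w s = pt (z - w) (t - s)"
  by (simp add: vec_eq_iff forall_3)

lemma pt_minus: "- pt z t = pt (- z) (- t)"
  by (simp add: vec_eq_iff forall_3)

lemma pt_scaleR: "a *\<^sub>R pt z t = pt (of_real a * z) (a * t)"
  by (simp add: vec_eq_iff forall_3)

lemma inner_pt: "pt z t \<bullet> pt w s = Re (z * cnj w) + t * s"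
  by (simp add: inner_vec_def sum_3)

lemma norm_pt_power2: "(norm (pt z t))\<^sup>2 = (cmod z)\<^sup>2 + t\<^sup>2"
  unfolding cmod_power2 unfolding power2_norm_eq_inner inner_pt
  by (simp add: power2_eq_square)

text \<open>Stated over the complex numbers because the right side is the radicand in
  \<open>xi1\<close>: it identifies that radicand with the squared distance from the source.\<close>

lemma norm_pt_square: "(complex_of_real (norm (pt z v)))\<^sup>2 = (of_real v)\<^sup>2 + z * cnj z"
proof -
  have "(of_real (norm (pt z v)))\<^sup>2 = complex_of_real ((cmod z)\<^sup>2 + v\<^sup>2)"
    by (simp flip: norm_pt_power2)
  then show ?thesis
    using complex_norm_square[of z] by simp
qed

lemma norm_pt_eq_1_iff: "norm (pt z v) = 1 \<longleftrightarrow> (of_real v)\<^sup>2 + z * cnj z = 1"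
proof -
  have "norm (pt z v) = 1 \<longleftrightarrow> (norm (pt z v))\<^sup>2 = 1"
    using norm_ge_zero[of "pt z v"] unfolding power2_eq_1_iff by linarith
  also have "\<dots> \<longleftrightarrow> (complex_of_real (norm (pt z v)))\<^sup>2 = 1"
    by (metis of_real_eq_1_iff of_real_power)
  finally show ?thesis
    unfolding norm_pt_square .
qed

lemma bounded_linear_pt: "bounded_linear (\<lambda>z. pt z 0)"
  unfolding linear_conv_bounded_linear [symmetric]
  by (rule linearI) (simp_all add: pt_add pt_scaleR, simp add: scaleR_conv_of_real)

lemma has_vector_derivative_pt:
  assumes "(z has_vector_derivative z') (at x within S)" "(t has_real_derivative t') (at x within S)"
  shows "((\<lambda>u. pt (z u) (t u)) has_vector_derivative pt z' t') (at x within S)"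
proof -
  have "((\<lambda>u. pt (z u) 0) has_vector_derivative pt z' 0) (at x within S)"
    by (rule bounded_linear.has_vector_derivative [OF bounded_linear_pt assms(1)])
  moreover have "((\<lambda>u. t u *\<^sub>R pt 0 1) has_vector_derivative t' *\<^sub>R pt 0 1) (at x within S)"
    using has_vector_derivative_scaleR[OF assms(2) has_vector_derivative_const, of "pt 0 1"]
    by simp
  ultimately have "((\<lambda>u. pt (z u) 0 + t u *\<^sub>R pt 0 1) has_vector_derivative pt z' 0 + t' *\<^sub>R pt 0 1) (at x within S)"
    by (rule has_vector_derivative_add)
  then show ?thesis
    by (simp add: pt_add pt_scaleR)
qed

section \<open>Stereographic coordinates of directions and of oriented lines\<close>

lemma one_plus_mult_cnj: "1 + \<xi> * cnj \<xi> = of_real (1 + (cmod \<xi>)\<^sup>2)"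
  using complex_norm_square[of \<xi>] by simp

lemma one_plus_mult_cnj_nonzero [simp]: "1 + \<xi> * cnj \<xi> \<noteq> 0"
  unfolding one_plus_mult_cnj of_real_eq_0_iff
  by (metis add_pos_nonneg less_irrefl zero_le_power2 zero_less_one)

text \<open>Clearing denominators turns later claims into polynomial identities within reach of
  \<open>algebra\<close>. The factor \<open>of_real t\<close> certifies that the quotient under
  \<open>Re\<close> is real.\<close>

lemma stereo_dir_eqI:
  assumes "2 * \<xi> = (1 + \<xi> * cnj \<xi>) * w" "1 - \<xi> * cnj \<xi> = (1 + \<xi> * cnj \<xi>) * of_real t"
  shows "stereo_dir \<xi> = pt w t"
  unfolding stereo_dir_def assms by simp

lemma stereo_dir_pt:
  obtains w t where "stereo_dir \<xi> = pt w t"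
    "2 * \<xi> = (1 + \<xi> * cnj \<xi>) * w" "1 - \<xi> * cnj \<xi> = (1 + \<xi> * cnj \<xi>) * of_real t"
proof -
  define w where "w = 2 * \<xi> / (1 + \<xi> * cnj \<xi>)"
  define t where "t = (1 - (cmod \<xi>)\<^sup>2) / (1 + (cmod \<xi>)\<^sup>2)"
  have w: "2 * \<xi> = (1 + \<xi> * cnj \<xi>) * w"
    by (simp add: w_def)
  have "of_real t = (1 - \<xi> * cnj \<xi>) / (1 + \<xi> * cnj \<xi>)"
    unfolding t_def using complex_norm_square[of \<xi>] by simp
  then have t: "1 - \<xi> * cnj \<xi> = (1 + \<xi> * cnj \<xi>) * of_real t"
    by simp
  show thesis
    using that stereo_dir_eqI[OF w t] w t by blast
qed


lemma line_point_eqI: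
  assumes "2 * (\<eta> - cnj \<eta> * \<xi>\<^sup>2) + 2 * \<xi> * (1 + \<xi> * cnj \<xi>) * of_real r = (1 + \<xi> * cnj \<xi>)\<^sup>2 * w"
    and "- 2 * (\<eta> * cnj \<xi> + cnj \<eta> * \<xi>) + (1 - \<xi>\<^sup>2 * (cnj \<xi>)\<^sup>2) * of_real r
          = (1 + \<xi> * cnj \<xi>)\<^sup>2 * of_real t"
  shows "line_point \<xi> \<eta> r = pt w t"
  unfolding line_point_def assms by simp

text \<open>The point of the line closest to the origin is p - (p . d) d, so p itself sits at signed
  arclength p . d. This explains the shift of the parameter.\<close>

lemma line_point_through:
  assumes \<eta>: "2 * \<eta> = z - 2 * of_real t * \<xi> - cnj z * \<xi>\<^sup>2"
  shows "line_point \<xi> \<eta> (r + pt z t \<bullet> stereo_dir \<xi>) = pt z t + r *\<^sub>R stereo_dir \<xi>"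
proof -
  obtain w s where p: "stereo_dir \<xi> = pt w s"
    and w: "2 * \<xi> = (1 + \<xi> * cnj \<xi>) * w"
    and s: "1 - \<xi> * cnj \<xi> = (1 + \<xi> * cnj \<xi>) * of_real s"
    by (rule stereo_dir_pt)
  \<comment> \<open>To \<open>algebra\<close> a number and its conjugate are unrelated
    indeterminates, so conjugated equations are supplied separately.\<close>
  have w': "2 * cnj \<xi> = (1 + \<xi> * cnj \<xi>) * cnj w"
    using arg_cong[OF w, of cnj] by (simp add: mult.commute)
  have \<eta>': "2 * cnj \<eta> = cnj z - 2 * of_real t * cnj \<xi> - z * (cnj \<xi>)\<^sup>2"
    using arg_cong[OF \<eta>, of cnj] by simp
  define a where "a = pt z t \<bullet> stereo_dir \<xi>"
  have a: "2 * complex_of_real a = z * cnj w + cnj z * w + 2 * of_real t * of_real s"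
    by (simp add: a_def p inner_pt complex_eq_iff algebra_simps)
  \<comment> \<open>The inner product with its denominator cleared, so that \<open>a\<close> can be
    eliminated from both coordinates.\<close>
  have Da: "(1 + \<xi> * cnj \<xi>) * of_real a = z * cnj \<xi> + cnj z * \<xi> + of_real t * (1 - \<xi> * cnj \<xi>)"
    using a w w' s by algebra
  have "line_point \<xi> \<eta> (r + a) = pt (z + of_real r * w) (t + r * s)"
  proof (rule line_point_eqI)
    show "2 * (\<eta> - cnj \<eta> * \<xi>\<^sup>2) + 2 * \<xi> * (1 + \<xi> * cnj \<xi>) * of_real (r + a)
        = (1 + \<xi> * cnj \<xi>)\<^sup>2 * (z + of_real r * w)"
      unfolding of_real_add using \<eta> \<eta>' Da w by algebra
    show "- 2 * (\<eta> * cnj \<xi> + cnj \<eta> * \<xi>) + (1 - \<xi>\<^sup>2 * (cnj \<xi>)\<^sup>2) * of_real (r + a)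
        = (1 + \<xi> * cnj \<xi>)\<^sup>2 * of_real (t + r * s)"
      unfolding of_real_add of_real_mult using \<eta> \<eta>' Da s by algebra
  qed
  then show ?thesis
    by (simp add: a_def p pt_add pt_scaleR)
qed

text \<open>An oriented line remembers only its point set and direction, so the arclength offset in
  \<open>line_point_through\<close> is absorbed by a translation of the parameter.\<close>

lemma coord_line_eq_oriented_line:
  assumes "2 * \<eta> = z - 2 * of_real t * \<xi> - cnj z * \<xi>\<^sup>2"
  shows "coord_line \<xi> \<eta> = oriented_line (pt z t) (stereo_dir \<xi>)"
proof -
  have "range (line_point \<xi> \<eta>) = range (\<lambda>r. line_point \<xi> \<eta> (r + pt z t \<bullet> stereo_dir \<xi>))"
    using image_image[of "line_point \<xi> \<eta>" "\<lambda>r. r + pt z t \<bullet> stereo_dir \<xi>" UNIV]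
    by (simp add: surj_plus_right)
  then show ?thesis
    by (simp add: coord_line_def oriented_line_def line_point_through[OF assms])
qed

lemma line_point_origin: "line_point \<xi> 0 r = r *\<^sub>R stereo_dir \<xi>"
  using line_point_through[of 0 0 0 \<xi> r] by simp

lemma coord_line_origin: "coord_line \<xi> 0 = oriented_line 0 (stereo_dir \<xi>)"
  using coord_line_eq_oriented_line[of 0 0 0 \<xi>] by simp

section \<open>Lines through the source and reflection of directions\<close>

lemma oriented_line_shift: "oriented_line (p + a *\<^sub>R d) d = oriented_line p d"
proof -
  have "range (\<lambda>r. p + r *\<^sub>R d) = range (\<lambda>r. p + (a + r) *\<^sub>R d)"
    using image_image[of "\<lambda>r. p + r *\<^sub>R d" "(+) a" UNIV] by simp
  then show ?thesis
    by (simp add: oriented_line_def algebra_simps)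
qed

text \<open>With the base point slid to the origin, \<open>q\<close> is a nonzero multiple of the
  unit direction, which is therefore \<open>sgn q\<close> up to the sign of the multiple.\<close>

lemma oriented_lines_through_origin:
  assumes "q \<noteq> 0"
  shows "{l. is_oriented_line l \<and> 0 \<in> snd l \<and> q \<in> snd l}
    = {oriented_line 0 (sgn q), oriented_line 0 (- sgn q)}" (is "?L = ?R")
proof
  show "?L \<subseteq> ?R"
  proof
    fix l assume "l \<in> ?L"
    then obtain p d where d: "norm d = 1" and l: "l = oriented_line p d"
      and "0 \<in> snd (oriented_line p d)" "q \<in> snd (oriented_line p d)"
      by (auto simp: is_oriented_line_def)
    then obtain a b where a: "0 = p + a *\<^sub>R d" and b: "q = p + b *\<^sub>R d"
      unfolding oriented_line_def snd_conv by blast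
    have l0: "l = oriented_line 0 d"
      using oriented_line_shift[of p a d] a l by simp
    have q: "q = (b - a) *\<^sub>R d"
      using a b by (metis add_diff_cancel_left diff_zero scaleR_left_diff_distrib)
    then have "sgn q = sgn (b - a) *\<^sub>R d"
      using d by (simp add: sgn_scaleR) (simp add: sgn_div_norm)
    moreover have "b - a \<noteq> 0"
      using q assms by auto
    ultimately have "d = sgn q \<or> d = - sgn q"
      by (auto simp: sgn_real_def)
    then show "l \<in> ?R"
      using l0 by auto
  qed
  have on_line: "a *\<^sub>R d \<in> snd (oriented_line 0 d)" for a and d :: "real^3"
    unfolding oriented_line_def by (auto intro: image_eqI[of _ _ a])
  have "norm q *\<^sub>R sgn q = q" "(- norm q) *\<^sub>R (- sgn q) = q"
    using assms by (simp_all add: sgn_div_norm)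
  then have "{0, q} \<subseteq> snd (oriented_line 0 (sgn q)) \<inter> snd (oriented_line 0 (- sgn q))"
    using on_line[of 0] on_line[of "norm q" "sgn q"] on_line[of "- norm q" "- sgn q"] by simp
  moreover have "is_oriented_line (oriented_line 0 (sgn q))"
    "is_oriented_line (oriented_line 0 (- sgn q))"
    unfolding is_oriented_line_def using assms by (metis norm_sgn norm_minus_cancel)+
  ultimately show "?R \<subseteq> ?L"
    by auto
qed

text \<open>Reflection is quadratic in the normal, hence blind to its orientation.\<close>

lemma reflect_dir_minus [simp]: "reflect_dir (- n) d = reflect_dir n d"
  by (simp add: reflect_dir_def)

text \<open>For a unit \<open>x0\<close> the subtracted term (w cnj x0 + cnj w x0) x0 equals w +
  x0^2 cnj w, which leaves - x0^2 cnj w.\<close>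

lemma reflect_dir_stereo_dir:
  assumes "x0 * cnj x0 = 1"
  shows "reflect_dir (pt x0 0) (stereo_dir x1) = stereo_dir (refl_xi x0 x1)"
proof -
  obtain w t where p: "stereo_dir x1 = pt w t"
    and w: "2 * x1 = (1 + x1 * cnj x1) * w"
    and t: "1 - x1 * cnj x1 = (1 + x1 * cnj x1) * of_real t"
    by (rule stereo_dir_pt)
  have w': "2 * cnj x1 = (1 + x1 * cnj x1) * cnj w"
    using arg_cong[OF w, of cnj] by (simp add: mult.commute)
  have "complex_of_real (2 * Re (w * cnj x0)) = w * cnj x0 + cnj w * x0"
    by (simp add: complex_eq_iff)
  then have "reflect_dir (pt x0 0) (pt w t) = pt (w - (w * cnj x0 + cnj w * x0) * x0) t"
    by (simp add: reflect_dir_def inner_pt pt_scaleR pt_diff)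
  also have "w - (w * cnj x0 + cnj w * x0) * x0 = - (x0\<^sup>2) * cnj w"
    using assms by algebra
  also have "pt \<dots> t = stereo_dir (refl_xi x0 x1)"
  proof (rule stereo_dir_eqI [symmetric])
    have "refl_xi x0 x1 * cnj (refl_xi x0 x1) = (x0 * cnj x0)\<^sup>2 * (x1 * cnj x1)"
      by (simp add: refl_xi_def power2_eq_square)
    \<comment> \<open>The coordinate keeps its modulus, so the denominator and the height are
      unchanged.\<close>
    then have D: "refl_xi x0 x1 * cnj (refl_xi x0 x1) = x1 * cnj x1"
      by (simp add: assms)
    show "2 * refl_xi x0 x1 = (1 + refl_xi x0 x1 * cnj (refl_xi x0 x1)) * (- (x0\<^sup>2) * cnj w)"
      unfolding D unfolding refl_xi_def using w' by algebra
    show "1 - refl_xi x0 x1 * cnj (refl_xi x0 x1)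
        = (1 + refl_xi x0 x1 * cnj (refl_xi x0 x1)) * of_real t"
      unfolding D by (rule t)
  qed
  finally show ?thesis
    by (simp add: p)
qed

section \<open>The rays from the source and the incidence of the reflected line\<close>

lemma xi1_eq: "xi1 \<sigma> z v = (\<sigma> * of_real (norm (pt z v)) - of_real v) / cnj z"
proof -
  \<comment> \<open>The radicand is the square of a nonnegative real, so the principal root is the
    distance itself.\<close>
  have "csqrt ((of_real v)\<^sup>2 + z * cnj z) = of_real (norm (pt z v))"
    unfolding norm_pt_square [symmetric]
    by (metis csqrt_of_real norm_ge_zero of_real_power real_sqrt_abs2 real_sqrt_unique zero_le_power2)
  then show ?thesis
    by (simp add: xi1_def)
qed

text \<open>With s the norm of (z, v), the unit vector \<sigma>(z, v)/s has stereographic coordinate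
  z/(\<sigma>s + v). This equals (\<sigma>s - v)/cnj z because s^2 - v^2 = z cnj z.\<close>

lemma stereo_dir_xi1:
  assumes "z \<noteq> 0" "\<sigma> = 1 \<or> \<sigma> = -1"
  shows "stereo_dir (xi1 (of_real \<sigma>) z v) = \<sigma> *\<^sub>R sgn (pt z v)"
proof -
  define s where "s = norm (pt z v)"
  have s: "(of_real s)\<^sup>2 = (of_real v)\<^sup>2 + z * cnj z"
    unfolding s_def by (rule norm_pt_square)
  have s0: "complex_of_real s \<noteq> 0"
    using assms(1) by (simp add: s_def)
  define c where "c = complex_of_real \<sigma>"
  have c: "c\<^sup>2 = 1"
    using assms(2) by (auto simp: c_def)
  define x where "x = xi1 c z v"
  have x: "x * cnj z = c * of_real s - of_real v"
    using assms(1) by (simp add: x_def xi1_eq s_def)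
  then have x': "cnj x * z = c * of_real s - of_real v"
    by (metis c_def complex_cnj_cnj complex_cnj_complex_of_real complex_cnj_diff complex_cnj_mult)
  have z: "z * cnj z \<noteq> 0" "cnj z \<noteq> 0"
    using assms(1) by simp_all
  have "stereo_dir x = pt (c * z / of_real s) (\<sigma> * v / s)"
  proof (rule stereo_dir_eqI)
    \<comment> \<open>The coordinate is known polynomially only through its product with
      \<open>cnj z\<close>, so this nonzero factor is inserted first and cancelled
      afterwards.\<close>
    have "cnj z * (2 * x * of_real s) = cnj z * ((1 + x * cnj x) * (c * z))"
      using x x' s c by algebra
    then have "2 * x * of_real s = (1 + x * cnj x) * (c * z)"
      using z(2) by (rule mult_left_cancel [THEN iffD1, rotated])
    then show "2 * x = (1 + x * cnj x) * (c * z / of_real s)"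
      using s0 by (simp add: field_simps)
    have "(z * cnj z) * ((1 - x * cnj x) * of_real s) = (z * cnj z) * ((1 + x * cnj x) * (c * of_real v))"
      using x x' s c by algebra
    then have "(1 - x * cnj x) * of_real s = (1 + x * cnj x) * (c * of_real v)"
      using z(1) by (rule mult_left_cancel [THEN iffD1, rotated])
    then show "1 - x * cnj x = (1 + x * cnj x) * of_real (\<sigma> * v / s)"
      using s0 by (simp add: field_simps c_def)
  qed
  then show ?thesis
    by (simp add: x_def c_def sgn_div_norm s_def pt_scaleR divide_inverse mult.commute mult.left_commute)
qed

text \<open>The direction is \<sigma> times \<open>sgn\<close> of the point, so the point lies at
  signed arclength \<sigma> times its norm, which is positive only for the plus sign.\<close>

lemma ray_iff:
  assumes "z \<noteq> 0" "\<sigma> \<in> {1, -1}"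
  shows "(\<exists>r>0. pt z v = line_point (xi1 \<sigma> z v) 0 r) \<longleftrightarrow> \<sigma> = 1"
proof
  have q: "pt z v = norm (pt z v) *\<^sub>R sgn (pt z v)" "sgn (pt z v) \<noteq> 0"
    using assms(1) by (simp_all add: sgn_div_norm sgn_zero_iff)
  {
    assume "\<exists>r>0. pt z v = line_point (xi1 \<sigma> z v) 0 r"
    then obtain r where r: "r > 0" "pt z v = line_point (xi1 \<sigma> z v) 0 r"
      by blast
    show "\<sigma> = 1"
    proof (rule ccontr)
      assume "\<sigma> \<noteq> 1"
      then have "\<sigma> = of_real (-1)"
        using assms(2) by simp
      then have "pt z v = (- r) *\<^sub>R sgn (pt z v)"
        using r(2) stereo_dir_xi1[OF assms(1), of "-1" v]
        unfolding line_point_origin by (metis scaleR_minus_left scaleR_minus_right scaleR_one)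
      then have "norm (pt z v) = - r"
        using q by (metis scaleR_cancel_right)
      then show False
        using r(1) norm_ge_zero[of "pt z v"] by linarith
    qed
  next
    assume "\<sigma> = 1"
    then have "pt z v = line_point (xi1 \<sigma> z v) 0 (norm (pt z v))"
      using q(1) stereo_dir_xi1[OF assms(1), of 1 v] by (simp add: line_point_origin)
    moreover have "norm (pt z v) > 0"
      using assms(1) by simp
    ultimately show "\<exists>r>0. pt z v = line_point (xi1 \<sigma> z v) 0 r"
      by blast
  }
qed

text \<open>Supplies the hypothesis of \<open>coord_line_eq_oriented_line\<close> at the point of
  reflection. With y = cnj xi1, replacing 2 v y by cnj z - z y^2 makes the right side factor as (x0
  - x0^3 y^2)(cnj x0 z + x0 cnj z).\<close>

lemma refl_eta_incidence:
  assumes "x0 * cnj x0 = 1" "z \<noteq> 0"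
  shows "2 * refl_eta x0 (xi1 1 z v) z v
    = z - 2 * of_real v * refl_xi x0 (xi1 1 z v) - cnj z * (refl_xi x0 (xi1 1 z v))\<^sup>2"
proof -
  define y where "y = cnj (xi1 1 z v)"
  define s where "s = complex_of_real (norm (pt z v))"
  have s: "s\<^sup>2 = (of_real v)\<^sup>2 + z * cnj z"
    unfolding s_def by (rule norm_pt_square)
  have y: "y * z = s - of_real v"
    using assms(2) by (simp add: y_def xi1_eq s_def)
  \<comment> \<open>A horizontal normal removes the \<open>v\<close> term and makes the denominator
    2.\<close>
  have r0: "2 * r0 x0 z v = cnj x0 * z + x0 * cnj z"
    by (simp add: r0_def assms(1))
  \<comment> \<open>Since \<open>y\<close> occurs squared and only \<open>y * z\<close> is given,
    the identity is proved after multiplication by z^2.\<close>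
  have "z * (z * (2 * ((cnj x0 - x0 * y\<^sup>2) * x0\<^sup>2 * r0 x0 z v)))
      = z * (z * (z - 2 * of_real v * (- (x0\<^sup>2) * y) - cnj z * (- (x0\<^sup>2) * y)\<^sup>2))"
    using y s r0 assms(1) by algebra
  then show ?thesis
    using assms(2) by (simp add: refl_eta_def refl_xi_def y_def)
qed

section \<open>Unit normals of the cylinder\<close>

lemma tangent_unit_iff:
  assumes "a \<noteq> 0"
  shows "w * cnj w = 1 \<and> Re (w * cnj a) = 0 \<longleftrightarrow> w\<^sup>2 = - (a / cnj a)"
proof
  have a: "cnj a \<noteq> 0"
    using assms by simp
  {
    assume *: "w * cnj w = 1 \<and> Re (w * cnj a) = 0"
    then have "w * cnj a + cnj w * a = 0"
      by (simp add: complex_eq_iff)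
    moreover have "w * cnj w = 1"
      using * ..
    \<comment> \<open>Multiply the orthogonality relation by \<open>w\<close> and use
      \<open>w * cnj w = 1\<close>.\<close>
    ultimately have "w\<^sup>2 * cnj a = - a"
      by algebra
    then show "w\<^sup>2 = - (a / cnj a)"
      using a by (metis minus_divide_left nonzero_eq_divide_eq)
  next
    assume w: "w\<^sup>2 = - (a / cnj a)"
    \<comment> \<open>The quotient \<open>a / cnj a\<close> has modulus 1.\<close>
    then have "(cmod w)\<^sup>2 = 1"
      using assms by (simp add: norm_divide flip: norm_power)
    then have 1: "w * cnj w = 1"
      by (metis complex_norm_square of_real_1)
    have "w\<^sup>2 * cnj a = - a"
      using w a by simp
    with 1 have "w * cnj a + cnj w * a = 0"
      by algebra
    then have "Re (w * cnj a) = 0"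
      by (simp add: complex_eq_iff algebra_simps)
    with 1 show "w * cnj w = 1 \<and> Re (w * cnj a) = 0"
      by simp
  }
qed

text \<open>The rulings have tangent \<open>pt 0 1\<close>, which forces the normal to be
  horizontal. The other tangent is horizontal already.\<close>

lemma unit_normal_cylinder_iff:
  assumes "z0 differentiable (at u)"
  shows "unit_normal (cylinder z0) u v (pt w t)
    \<longleftrightarrow> t = 0 \<and> w * cnj w = 1 \<and> Re (w * cnj (vector_derivative z0 (at u))) = 0"
proof -
  have "((\<lambda>u'. pt (z0 u') v) has_vector_derivative pt (vector_derivative z0 (at u)) 0) (at u)"
    using assms by (intro has_vector_derivative_pt) (auto simp: vector_derivative_works)
  moreover have "((\<lambda>v'. pt (z0 u) v') has_vector_derivative pt 0 1) (at v)"
    by (intro has_vector_derivative_pt) auto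
  ultimately show ?thesis
    by (auto simp: unit_normal_def cylinder_def vector_derivative_at inner_pt norm_pt_eq_1_iff)
qed

text \<open>Squaring removes both the sign and the choice of branch of the root.\<close>

lemma xi0_power2:
  assumes "z0 differentiable (at u)" "\<epsilon> \<in> {1, -1}"
  shows "(xi0 \<epsilon> z0 u)\<^sup>2
    = - (vector_derivative z0 (at u) / cnj (vector_derivative z0 (at u)))"
proof -
  have "\<epsilon>\<^sup>2 = 1"
    using assms(2) by auto
  then show ?thesis
    by (simp add: xi0_def power_mult_distrib vector_derivative_cnj[OF assms(1)])
qed

text \<open>The unit circle corresponds to the equator.\<close>

lemma stereo_dir_unit: "x * cnj x = 1 \<Longrightarrow> stereo_dir x = pt x 0"
  by (rule stereo_dir_eqI) simp_all

section \<open>The reflected congruence\<close>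

theorem proposition2:
  fixes z0 :: "real \<Rightarrow> complex"
  assumes "\<And>u. z0 differentiable (at u)"
    and "\<And>u. vector_derivative z0 (at u) \<noteq> 0"
    and "\<And>u. z0 u \<noteq> 0"
  shows "(\<forall>u v n. unit_normal (cylinder z0) u v n
             \<longleftrightarrow> (\<exists>\<epsilon>\<in>{1, -1}. n = stereo_dir (xi0 \<epsilon> z0 u)))
    \<and> (\<forall>u v. {l. is_oriented_line l \<and> 0 \<in> snd l \<and> cylinder z0 u v \<in> snd l}
             = {coord_line (xi1 \<sigma> (z0 u) v) 0 |\<sigma>. \<sigma> \<in> {1, -1}})
    \<and> (\<forall>u v. xi1 1 (z0 u) v \<noteq> xi1 (-1) (z0 u) v)
    \<and> (\<forall>u v. \<exists>!\<sigma>. \<sigma> \<in> {1, -1} \<and> (\<exists>r>0. cylinder z0 u v = line_point (xi1 \<sigma> (z0 u) v) 0 r))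
    \<and> (\<forall>(\<epsilon> :: real \<Rightarrow> complex) (\<sigma> :: real \<Rightarrow> real \<Rightarrow> complex) N.
          (\<forall>u. \<epsilon> u \<in> {1, -1}) \<longrightarrow>
          (\<forall>u v. \<sigma> u v \<in> {1, -1}
             \<and> (\<exists>r>0. cylinder z0 u v = line_point (xi1 (\<sigma> u v) (z0 u) v) 0 r)) \<longrightarrow>
          (\<forall>u v. unit_normal (cylinder z0) u v (N u v)) \<longrightarrow>
          source_reflection 0 (cylinder z0) N =
            (\<lambda>u v. coord_line
                     (refl_xi (xi0 (\<epsilon> u) z0 u) (xi1 (\<sigma> u v) (z0 u) v))
                     (refl_eta (xi0 (\<epsilon> u) z0 u) (xi1 (\<sigma> u v) (z0 u) v) (z0 u) v)))"
proof (intro conjI)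
  note xi0_sq = xi0_power2[OF assms(1)]
  have xi0_unit: "xi0 \<epsilon> z0 u * cnj (xi0 \<epsilon> z0 u) = 1" if "\<epsilon> \<in> {1, -1}" for \<epsilon> u
    using tangent_unit_iff[OF assms(2)] xi0_sq that by blast
  have normal_iff: "unit_normal (cylinder z0) u v n \<longleftrightarrow> (\<exists>\<epsilon>\<in>{1, -1}. n = pt (xi0 \<epsilon> z0 u) 0)"
    for u v n
  proof -
    obtain w t where n: "n = pt w t"
      by (rule pt_cases)
    \<comment> \<open>The two signs give both square roots, hence both unit normals.\<close>
    have "xi0 (-1) z0 u = - xi0 1 z0 u"
      by (simp add: xi0_def)
    then have "w\<^sup>2 = (xi0 1 z0 u)\<^sup>2 \<longleftrightarrow> (\<exists>\<epsilon>\<in>{1, -1}. w = xi0 \<epsilon> z0 u)"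
      by (simp add: power2_eq_iff)
    then show ?thesis
      unfolding n unit_normal_cylinder_iff[OF assms(1)] tangent_unit_iff[OF assms(2)]
      using xi0_sq[of 1 u] by auto
  qed
  show "\<forall>u v n. unit_normal (cylinder z0) u v n
      \<longleftrightarrow> (\<exists>\<epsilon>\<in>{1, -1}. n = stereo_dir (xi0 \<epsilon> z0 u))"
    unfolding normal_iff using stereo_dir_unit[OF xi0_unit] by (metis (no_types, lifting))
  have dir: "stereo_dir (xi1 1 (z0 u) v) = sgn (cylinder z0 u v)"
    "stereo_dir (xi1 (-1) (z0 u) v) = - sgn (cylinder z0 u v)" for u v
    using stereo_dir_xi1[OF assms(3), of 1] stereo_dir_xi1[OF assms(3), of "-1"]
    by (simp_all add: cylinder_def)
  have q: "cylinder z0 u v \<noteq> 0" for u v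
    using assms(3) by (simp add: cylinder_def)
  have signs: "{f \<sigma> |\<sigma>. \<sigma> \<in> {1, -1}} = {f 1, f (-1)}" for f :: "complex \<Rightarrow> oline"
    by blast
  show "\<forall>u v. {l. is_oriented_line l \<and> 0 \<in> snd l \<and> cylinder z0 u v \<in> snd l}
      = {coord_line (xi1 \<sigma> (z0 u) v) 0 |\<sigma>. \<sigma> \<in> {1, -1}}"
    unfolding signs oriented_lines_through_origin[OF q] coord_line_origin dir by simp
  \<comment> \<open>The two numerators differ by twice the distance from the source.\<close>
  show "\<forall>u v. xi1 1 (z0 u) v \<noteq> xi1 (-1) (z0 u) v"
    using assms(3) q by (simp add: xi1_eq cylinder_def)
  show "\<forall>u v. \<exists>!\<sigma>. \<sigma> \<in> {1, -1} \<and> (\<exists>r>0. cylinder z0 u v = line_point (xi1 \<sigma> (z0 u) v) 0 r)"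
  proof (intro allI)
    fix u v
    have "\<sigma> \<in> {1, -1} \<and> (\<exists>r>0. cylinder z0 u v = line_point (xi1 \<sigma> (z0 u) v) 0 r) \<longleftrightarrow> \<sigma> = 1" for \<sigma>
      unfolding cylinder_def using ray_iff[OF assms(3), of \<sigma> u v] by blast
    then show "\<exists>!\<sigma>. \<sigma> \<in> {1, -1} \<and> (\<exists>r>0. cylinder z0 u v = line_point (xi1 \<sigma> (z0 u) v) 0 r)"
      by simp
  qed
  show "\<forall>(\<epsilon> :: real \<Rightarrow> complex) (\<sigma> :: real \<Rightarrow> real \<Rightarrow> complex) N.
      (\<forall>u. \<epsilon> u \<in> {1, -1}) \<longrightarrow>
      (\<forall>u v. \<sigma> u v \<in> {1, -1}
         \<and> (\<exists>r>0. cylinder z0 u v = line_point (xi1 (\<sigma> u v) (z0 u) v) 0 r)) \<longrightarrow>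
      (\<forall>u v. unit_normal (cylinder z0) u v (N u v)) \<longrightarrow>
      source_reflection 0 (cylinder z0) N =
        (\<lambda>u v. coord_line
                 (refl_xi (xi0 (\<epsilon> u) z0 u) (xi1 (\<sigma> u v) (z0 u) v))
                 (refl_eta (xi0 (\<epsilon> u) z0 u) (xi1 (\<sigma> u v) (z0 u) v) (z0 u) v))"
  proof (intro allI impI ext)
    fix \<epsilon> :: "real \<Rightarrow> complex" and \<sigma> :: "real \<Rightarrow> real \<Rightarrow> complex" and N u v
    assume \<epsilon>: "\<forall>u. \<epsilon> u \<in> {1, -1}"
      and \<sigma>: "\<forall>u v. \<sigma> u v \<in> {1, -1}
        \<and> (\<exists>r>0. cylinder z0 u v = line_point (xi1 (\<sigma> u v) (z0 u) v) 0 r)"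
      and N: "\<forall>u v. unit_normal (cylinder z0) u v (N u v)"
    define x0 where "x0 = xi0 (\<epsilon> u) z0 u"
    have x0: "x0 * cnj x0 = 1"
      unfolding x0_def using \<epsilon> by (intro xi0_unit) blast
    have \<sigma>1: "\<sigma> u v = 1"
      using \<sigma> ray_iff[OF assms(3), of "\<sigma> u v" u v] by (auto simp: cylinder_def)
    \<comment> \<open>The sign of \<open>N\<close> is independent of \<epsilon> and may jump with
      \<open>u\<close> and \<open>v\<close>. Equal squares give \<open>N u v\<close> up to sign, and
      the reflection ignores that sign.\<close>
    obtain \<delta> where \<delta>: "\<delta> \<in> {1, -1}" "N u v = pt (xi0 \<delta> z0 u) 0"
      using N normal_iff by blast
    have "(xi0 \<delta> z0 u)\<^sup>2 = x0\<^sup>2"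
      by (simp only: x0_def xi0_sq[OF \<delta>(1)] xi0_sq[OF \<epsilon>[rule_format]])
    then have "N u v = pt x0 0 \<or> N u v = - pt x0 0"
      by (auto simp: \<delta>(2) power2_eq_iff pt_minus)
    then have "reflect_dir (N u v) (sgn (cylinder z0 u v)) = stereo_dir (refl_xi x0 (xi1 1 (z0 u) v))"
      using reflect_dir_stereo_dir[OF x0, of "xi1 1 (z0 u) v"] by (auto simp: dir)
    then show "source_reflection 0 (cylinder z0) N u v = coord_line
                 (refl_xi (xi0 (\<epsilon> u) z0 u) (xi1 (\<sigma> u v) (z0 u) v))
                 (refl_eta (xi0 (\<epsilon> u) z0 u) (xi1 (\<sigma> u v) (z0 u) v) (z0 u) v)"
      using coord_line_eq_oriented_line[OF refl_eta_incidence[OF x0 assms(3)]]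
      by (simp add: source_reflection_def \<sigma>1 flip: x0_def) (simp add: cylinder_def)
  qed
qed

end
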